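(* Let $\mathit{complete}$ be a procedure that, given a nonempty definite program $Q$, returns a collection complete for $Q$, and suppose it runs in time $O(t(m))$ on programs of size $m$. Consider the recursive algorithm $\mathit{stable}(P,L)$: if $L$ is consistent then, if $[P]_L=\emptyset$, check whether $L^+$ is a stable model of $P$ and if so output it; otherwise compute $\mathcal A:=\mathit{complete}([P]_L)$ and call $\mathit{stable}(P,L\cup A)$ for every $A\in\mathcal A$. Define $s(P,L)=1$ if $[P]_L=\emptyset$ or $L$ is not consistent, and otherwise $s(P,L)=\sum_{A\in\mathcal A}s(P,L\cup A)$ with $\mathcal A=\mathit{complete}([P]_L)$. Then for a finite definite program $P$ of size $m$ and $L\subseteq\mathit{Lit}(P)$, executing $\mathit{stable}(P,L)$ requires $O(s(P,L)(t(m)+m))$ steps in the worst case.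
   Context: A clause is $p\leftarrow B$ (definite) or $\leftarrow B$ (constraint), with head atom $p=h(c)$ and body $B$ a finite set of literals (atoms $a$ or $\mathrm{not}(a)$); $b^+(c)$, $b^-(c)$ are the sets of atoms occurring positively, resp. negated, in the body. A logic program is a finite set of clauses; definite if all clauses are definite; its size $m$ is the size of its standard representation (total number of occurrences of atoms). $\mathit{At}(P)$ is its set of atoms, $\mathit{Lit}(P)=\mathit{At}(P)\cup\{\mathrm{not}(a):a\in\mathit{At}(P)\}$. $M\subseteq\mathit{At}(P)$ is a stable model of $P$ if $M$ satisfies all constraints of $P$ and is the least model of the Gelfond–Lifschitz reduct $P^M$ (delete definite clauses $c$ with $b^-(c)\cap M\neq\emptyset$, drop negated literals from the rest). For $L\subseteq\mathit{Lit}(P)$: $L^+=\{a:a\in L\}$, $L^-=\{a:\mathrm{not}(a)\in L\}$, $L^0=L^+\cup L^-$; $L$ is consistent if $L^+\cap L^-=\emptyset$; $M$ is consistent with $L$ if $L^+\subseteq M$, $L^-\cap M=\emptyset$. $[P]_L$ is obtained from $P$ by removing clauses $c$ with $b^+(c)\cap L^-\neq\emptyset$, with $b^-(c)\cap L^+\neq\emptyset$, or with $h(c)\in L^0$, then deleting occurrences of literals of $L$ from the remaining bodies. A nonempty collection $\mathcal A$ of nonempty subsets of $\mathit{Lit}(Q)$ is complete for $Q$ if every stable model of $Q$ is consistent with some $A\in\mathcal A$.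
   Formalization: Added: every collection returned by complete has at least two sets (with one-element collections long chains have s=1 and the bound fails); t is nonnegative and nondecreasing; P is nonempty; the O-constants hold for all sizes m≥1. *)

theory Defs
  imports Complex_Main
begin

section \<open>Logic programs and stable models\<close>

datatype 'a literal = Pos 'a | Neg 'a

fun dual :: "'a literal \<Rightarrow> 'a literal" where
  "dual (Pos a) = Neg a"
| "dual (Neg a) = Pos a"

text \<open>The head \<^term>\<open>None\<close> marks a constraint.\<close>

datatype 'a clause = Clause (head: "'a option") (body: "'a literal set")

type_synonym 'a program = "'a clause set"

definition pos_atoms :: "'a literal set \<Rightarrow> 'a set" where
  "pos_atoms L = {a. Pos a \<in> L}"

definition neg_atoms :: "'a literal set \<Rightarrow> 'a set" where
  "neg_atoms L = {a. Neg a \<in> L}"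

definition At :: "'a program \<Rightarrow> 'a set" where
  "At P = (\<Union>c\<in>P. set_option (head c) \<union> pos_atoms (body c) \<union> neg_atoms (body c))"

definition Lit :: "'a program \<Rightarrow> 'a literal set" where
  "Lit P = Pos ` At P \<union> Neg ` At P"

definition finite_program :: "'a program \<Rightarrow> bool" where
  "finite_program P \<longleftrightarrow> finite P \<and> (\<forall>c\<in>P. finite (body c))"

definition definite :: "'a program \<Rightarrow> bool" where
  "definite P \<longleftrightarrow> (\<forall>c\<in>P. head c \<noteq> None)"

definition program_size :: "'a program \<Rightarrow> nat" where
  "program_size P = (\<Sum>c\<in>P. card (set_option (head c)) + card (body c))"

definition satisfies :: "'a set \<Rightarrow> 'a clause \<Rightarrow> bool" where
  "satisfies M c \<longleftrightarrow>
     (pos_atoms (body c) \<subseteq> M \<and> neg_atoms (body c) \<inter> M = {} \<longrightarrow> (\<exists>p\<in>set_option (head c). p \<in> M))"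

definition is_model :: "'a program \<Rightarrow> 'a set \<Rightarrow> bool" where
  "is_model P M \<longleftrightarrow> (\<forall>c\<in>P. satisfies M c)"

definition is_least_model :: "'a program \<Rightarrow> 'a set \<Rightarrow> bool" where
  "is_least_model P M \<longleftrightarrow> is_model P M \<and> (\<forall>N. is_model P N \<longrightarrow> M \<subseteq> N)"

definition reduct :: "'a program \<Rightarrow> 'a set \<Rightarrow> 'a program" where
  "reduct P M = {Clause (head c) (Pos ` pos_atoms (body c)) | c.
     c \<in> P \<and> head c \<noteq> None \<and> neg_atoms (body c) \<inter> M = {}}"

definition stable_model :: "'a program \<Rightarrow> 'a set \<Rightarrow> bool" where
  "stable_model P M \<longleftrightarrow>
     M \<subseteq> At P \<and> (\<forall>c\<in>P. head c = None \<longrightarrow> satisfies M c) \<and> is_least_model (reduct P M) M"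

definition consistent :: "'a literal set \<Rightarrow> bool" where
  "consistent L \<longleftrightarrow> pos_atoms L \<inter> neg_atoms L = {}"

definition consistent_with :: "'a set \<Rightarrow> 'a literal set \<Rightarrow> bool" where
  "consistent_with M L \<longleftrightarrow> pos_atoms L \<subseteq> M \<and> neg_atoms L \<inter> M = {}"

text \<open>\<^term>\<open>residual P L\<close> is the program written \<open>[P]\<^sub>L\<close>.\<close>

definition residual :: "'a program \<Rightarrow> 'a literal set \<Rightarrow> 'a program" where
  "residual P L = {Clause (head c) (body c - L) | c. c \<in> P
     \<and> pos_atoms (body c) \<inter> neg_atoms L = {}
     \<and> neg_atoms (body c) \<inter> pos_atoms L = {}
     \<and> set_option (head c) \<inter> (pos_atoms L \<union> neg_atoms L) = {}}"

definition complete_for :: "'a program \<Rightarrow> 'a literal set set \<Rightarrow> bool" where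
  "complete_for Q \<A> \<longleftrightarrow>
     \<A> \<noteq> {} \<and> (\<forall>A\<in>\<A>. A \<noteq> {} \<and> A \<subseteq> Lit Q) \<and>
     (\<forall>M. stable_model Q M \<longrightarrow> (\<exists>A\<in>\<A>. consistent_with M A))"

text \<open>The recurrence for \<open>s(P,L)\<close>. No termination proof is attached, since the recursion terminates
  only for a correct procedure \<^term>\<open>f\<close>; see \<open>branches_eq\<close> below.\<close>

function (domintros) branches ::
  "('a program \<Rightarrow> 'a literal set set) \<Rightarrow> 'a program \<Rightarrow> 'a literal set \<Rightarrow> nat" where
  "branches f P L =
     (if residual P L = {} \<or> \<not> consistent L then 1
      else (\<Sum>A\<in>f (residual P L). branches f P (L \<union> A)))"
  by pat_completeness auto


section \<open>Counting steps\<close>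

text \<open>A computation yields a result and the number of elementary steps it takes (uniform cost).
  Each \<open>ret e\<close> is one step: \<open>e\<close> is built from a bounded number of elementary operations, namely
  arithmetic and comparisons on small numbers, consing to a list and inspecting its first cell, and
  access to tables. Tables (arrays indexed by atoms, literals or clause numbers) are modelled by
  functions; a lookup, an update \<open>tab(x := v)\<close> and the creation of a constant table are elementary
  operations, as usual for sparse arrays.\<close>

type_synonym 'r timed = "'r \<times> nat"

abbreviation val :: "'r timed \<Rightarrow> 'r" where "val \<equiv> fst"
abbreviation steps :: "'r timed \<Rightarrow> nat" where "steps \<equiv> snd"

definition ret :: "'r \<Rightarrow> 'r timed" where
  "ret x = (x, 1)"

definition bind :: "'r timed \<Rightarrow> ('r \<Rightarrow> 'q timed) \<Rightarrow> 'q timed" (infixl "\<bind>" 54) where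
  "m \<bind> f = (val (f (val m)), steps m + steps (f (val m)))"

fun loop :: "('x \<Rightarrow> 's \<Rightarrow> 's timed) \<Rightarrow> 'x list \<Rightarrow> 's \<Rightarrow> 's timed" where
  "loop f [] s = ret s"
| "loop f (x # xs) s = ret s \<bind> f x \<bind> loop f xs"

lemma bind_cong [fundef_cong]:
  "m = m' \<Longrightarrow> f (val m') = f' (val m') \<Longrightarrow> (m \<bind> f) = (m' \<bind> f')"
  by (simp add: bind_def)

lemma loop_cong [fundef_cong]:
  "xs = ys \<Longrightarrow> s = s' \<Longrightarrow> (\<And>x s. x \<in> set ys \<Longrightarrow> f x s = g x s) \<Longrightarrow> loop f xs s = loop g ys s'"
  by (induction xs arbitrary: ys s s') (auto simp: bind_def)

declare sum.cong [fundef_cong]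


section \<open>The algorithm\<close>

text \<open>Programs are stored as lists of clauses and bodies as lists of literals.\<close>

type_synonym 'a clause_list = "('a option \<times> 'a literal list) list"

definition program_of :: "'a clause_list \<Rightarrow> 'a program" where
  "program_of cs = (\<lambda>(h, B). Clause h (set B)) ` set cs"

definition lists_program :: "'a clause_list \<Rightarrow> 'a program \<Rightarrow> bool" where
  "lists_program cs P \<longleftrightarrow> program_of cs = P \<and>
     distinct (map (\<lambda>(h, B). Clause h (set B)) cs) \<and> (\<forall>(h, B)\<in>set cs. distinct B)"

definition lists_set :: "'b list \<Rightarrow> 'b set \<Rightarrow> bool" where
  "lists_set xs X \<longleftrightarrow> distinct xs \<and> set xs = X"

definition lists_collection :: "'b list list \<Rightarrow> 'b set set \<Rightarrow> bool" where
  "lists_collection xss \<X> \<longleftrightarrow> lists_set (map set xss) \<X> \<and> (\<forall>xs\<in>set xss. distinct xs)"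

definition mark_proc :: "'b list \<Rightarrow> ('b \<Rightarrow> bool) timed" where
  "mark_proc xs = loop (\<lambda>x tab. ret (tab(x := True))) xs (\<lambda>_. False)"

definition consistent_proc :: "'a literal list \<Rightarrow> bool timed" where
  "consistent_proc ls =
     mark_proc ls \<bind> (\<lambda>tab. loop (\<lambda>l ok. ret (ok \<and> \<not> tab (dual l))) ls True)"

definition residual_proc :: "'a clause_list \<Rightarrow> 'a literal list \<Rightarrow> 'a clause_list timed" where
  "residual_proc cs ls =
     mark_proc ls \<bind> (\<lambda>tab.
     loop (\<lambda>(h, B) acc.
       ret (case h of None \<Rightarrow> True | Some p \<Rightarrow> \<not> tab (Pos p) \<and> \<not> tab (Neg p)) \<bind> (\<lambda>keep.
       loop (\<lambda>l (keep, B'). ret (keep \<and> \<not> tab (dual l), if tab l then B' else l # B'))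
         B (keep, []) \<bind> (\<lambda>(keep, B').
       ret (if keep then (h, B') # acc else acc)))) cs [])"

definition positive_proc :: "'a literal list \<Rightarrow> 'a list timed" where
  "positive_proc ls = loop (\<lambda>l M. ret (case l of Pos a \<Rightarrow> a # M | Neg a \<Rightarrow> M)) ls []"

text \<open>Computes the reduct with respect to the set tabulated by \<open>tab\<close>, and checks the constraints.\<close>

definition reduct_proc ::
  "('a \<Rightarrow> bool) \<Rightarrow> 'a clause_list \<Rightarrow> (bool \<times> ('a \<times> 'a list) list) timed" where
  "reduct_proc tab cs =
     loop (\<lambda>(h, B) (ok, R).
       loop (\<lambda>l (blocked, sat, ps). ret (case l of
            Pos a \<Rightarrow> (blocked, sat \<and> tab a, a # ps)
          | Neg a \<Rightarrow> (blocked \<or> tab a, sat, ps))) B (False, True, []) \<bind> (\<lambda>(blocked, sat, ps).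
       ret (case h of
            None \<Rightarrow> (ok \<and> (blocked \<or> \<not> sat), R)
          | Some p \<Rightarrow> (ok, if blocked then R else (p, ps) # R)))) cs (True, [])"

text \<open>The linear-time computation of least models due to Dowling and Gallier. For the clause with
  number \<open>i\<close>, \<open>hds i\<close> is its head and \<open>cnt i\<close> the number of body atoms not derived yet; \<open>occ a\<close>
  lists the clauses with \<open>a\<close> in the body; \<open>wl\<close> holds the atoms still to be processed.\<close>

definition index_proc ::
  "('a \<times> 'a list) list \<Rightarrow>
   (nat \<times> (nat \<Rightarrow> nat) \<times> (nat \<Rightarrow> 'a) \<times> ('a \<Rightarrow> nat list) \<times> 'a list) timed" where
  "index_proc R =
     loop (\<lambda>(p, ps) (k, cnt, hds, occ, wl).
       loop (\<lambda>a (n, occ). ret (Suc n, occ(a := k # occ a))) ps (0, occ) \<bind> (\<lambda>(n, occ).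
       ret (Suc k, cnt(k := n), hds(k := p), occ, if n = 0 then p # wl else wl)))
     R (0, \<lambda>_. 0, \<lambda>_. undefined, \<lambda>_. [], [])"

text \<open>Every clause puts its head into \<open>wl\<close> at most once, hence \<open>length R\<close> rounds are enough.\<close>

definition least_model_proc :: "('a \<times> 'a list) list \<Rightarrow> ('a list \<times> ('a \<Rightarrow> bool)) timed" where
  "least_model_proc R =
     index_proc R \<bind> (\<lambda>(k, cnt, hds, occ, wl).
     loop (\<lambda>_ (D, der, cnt, wl). case wl of
         [] \<Rightarrow> ret (D, der, cnt, wl)
       | a # wl' \<Rightarrow>
           if der a then ret (D, der, cnt, wl')
           else loop (\<lambda>i (cnt, wl).
                  ret (cnt(i := cnt i - 1), if cnt i = 1 then hds i # wl else wl))
                (occ a) (cnt, wl') \<bind> (\<lambda>(cnt, wl). ret (a # D, der(a := True), cnt, wl)))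
       R ([], \<lambda>_. False, cnt, wl) \<bind> (\<lambda>(D, der, cnt, wl).
     ret (D, der)))"

definition stable_check_proc :: "'a clause_list \<Rightarrow> 'a list \<Rightarrow> bool timed" where
  "stable_check_proc cs M =
     mark_proc M \<bind> (\<lambda>tab.
     reduct_proc tab cs \<bind> (\<lambda>(ok, R).
     least_model_proc R \<bind> (\<lambda>(D, der).
     loop (\<lambda>a b. ret (b \<and> tab a)) D True \<bind> (\<lambda>sub.
     loop (\<lambda>a b. ret (b \<and> der a)) M True \<bind> (\<lambda>sup.
     ret (ok \<and> sub \<and> sup))))))"

text \<open>The sets output so far are collected in \<open>out\<close>. As for \<^const>\<open>branches\<close>, termination depends
  on the procedure \<open>c\<close>; see \<open>stable_proc_eq\<close> below.\<close>

function (domintros) stable_proc ::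
  "('a program \<Rightarrow> 'a literal list list timed) \<Rightarrow> 'a clause_list \<Rightarrow> 'a literal list \<Rightarrow>
   'a list list \<Rightarrow> 'a list list timed" where
  "stable_proc c cs ls out =
     consistent_proc ls \<bind> (\<lambda>ok.
     if \<not> ok then ret out
     else residual_proc cs ls \<bind> (\<lambda>qs.
       if qs = [] then
         positive_proc ls \<bind> (\<lambda>M.
         stable_check_proc cs M \<bind> (\<lambda>b.
         ret (if b then M # out else out)))
       else
         c (program_of qs) \<bind> (\<lambda>As.
         loop (\<lambda>A out.
           loop (\<lambda>l ls'. ret (l # ls')) A ls \<bind> (\<lambda>ls'.
           stable_proc c cs ls' out)) As out)))"
  by pat_completeness auto


section \<open>Termination\<close>

lemma finite_Lit: "finite_program P \<Longrightarrow> finite (Lit P)"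
proof -
  have "finite (pos_atoms B)" "finite (neg_atoms B)" if "finite B" for B :: "'a literal set"
  proof -
    have "pos_atoms B = Pos -` B" "neg_atoms B = Neg -` B"
      by (auto simp: pos_atoms_def neg_atoms_def)
    with that show "finite (pos_atoms B)" "finite (neg_atoms B)"
      by (auto intro!: finite_vimageI injI)
  qed
  then show "finite_program P \<Longrightarrow> finite (Lit P)"
    by (auto simp: finite_program_def Lit_def At_def)
qed

lemma residual_program:
  assumes "finite_program P" "definite P"
  shows "finite_program (residual P L)" "definite (residual P L)"
proof -
  have "residual P L \<subseteq> (\<lambda>c. Clause (head c) (body c - L)) ` P"
    by (auto simp: residual_def)
  with assms show "finite_program (residual P L)"
    by (auto simp: finite_program_def residual_def intro: finite_subset)
  show "definite (residual P L)"
    using assms by (auto simp: definite_def residual_def)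
qed

lemma Lit_residual: "Lit (residual P L) \<subseteq> Lit P" "Lit (residual P L) \<inter> L = {}"
proof -
  have *: "a \<in> At P \<and> Pos a \<notin> L \<and> Neg a \<notin> L" if "a \<in> At (residual P L)" for a
    using that by (fastforce simp: At_def residual_def pos_atoms_def neg_atoms_def)
  then show "Lit (residual P L) \<subseteq> Lit P" "Lit (residual P L) \<inter> L = {}"
    by (auto simp: Lit_def dest: *)
qed

lemma complete_decreases:
  assumes "finite_program P" "complete_for (residual P L) \<A>" "A \<in> \<A>"
  shows "card (Lit P - (L \<union> A)) < card (Lit P - L)"
proof (rule psubset_card_mono)
  show "finite (Lit P - L)" using assms finite_Lit by auto
  have "A \<noteq> {}" "A \<subseteq> Lit (residual P L)" using assms by (auto simp: complete_for_def)
  with Lit_residual[of P L] show "Lit P - (L \<union> A) \<subset> Lit P - L" by blast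
qed

lemma branches_dom:
  assumes f: "\<And>Q. finite_program Q \<Longrightarrow> definite Q \<Longrightarrow> Q \<noteq> {} \<Longrightarrow> complete_for Q (f Q)"
    and P: "finite_program P" "definite P"
  shows "branches_dom (f, P, L)"
proof (induction "card (Lit P - L)" arbitrary: L rule: less_induct)
  case less
  show ?case
    using less complete_decreases[OF P(1) f] residual_program[OF P]
    by (metis branches.domintros empty_iff)
qed

lemma branches_eq:
  assumes "\<And>Q. finite_program Q \<Longrightarrow> definite Q \<Longrightarrow> Q \<noteq> {} \<Longrightarrow> complete_for Q (f Q)"
    and "finite_program P" "definite P"
  shows "branches f P L =
     (if residual P L = {} \<or> \<not> consistent L then 1
      else (\<Sum>A\<in>f (residual P L). branches f P (L \<union> A)))"
  by (rule branches.psimps, rule branches_dom) (use assms in auto)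


section \<open>Correctness of the subroutines\<close>

lemma val_simps [simp]: "val (ret x) = x" "val (m \<bind> f) = val (f (val m))"
  by (simp_all add: ret_def bind_def)

lemma val_loop: "val (loop f xs s) = fold (\<lambda>x s. val (f x s)) xs s"
  by (induction xs arbitrary: s) auto

lemma loop_invariant:
  assumes "I [] s"
    and "\<And>xs x s. I xs s \<Longrightarrow> I (xs @ [x]) (val (f x s))"
  shows "I xs (val (loop f xs s))"
  by (induction xs rule: rev_induct) (auto simp: val_loop assms)

lemma mark_proc: "val (mark_proc xs) = (\<lambda>x. x \<in> set xs)"
  unfolding mark_proc_def
  by (rule loop_invariant[where I = "\<lambda>xs tab. tab = (\<lambda>x. x \<in> set xs)"]) (auto simp: fun_eq_iff)

lemma set_loop_Cons: "set (val (loop (\<lambda>l ls'. ret (l # ls')) A ls)) = set ls \<union> set A"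
  by (rule loop_invariant[where I = "\<lambda>A ls'. set ls' = set ls \<union> set A"]) auto

lemma consistent_proc: "val (consistent_proc ls) \<longleftrightarrow> consistent (set ls)"
proof -
  have "val (consistent_proc ls) \<longleftrightarrow> (\<forall>l\<in>set ls. dual l \<notin> set ls)"
    unfolding consistent_proc_def val_simps mark_proc
    by (rule loop_invariant[where I = "\<lambda>xs ok. ok \<longleftrightarrow> (\<forall>l\<in>set xs. dual l \<notin> set ls)"]) auto
  also have "\<dots> \<longleftrightarrow> consistent (set ls)"
  proof -
    have "dual l \<in> set ls \<longleftrightarrow> (case l of Pos a \<Rightarrow> Neg a \<in> set ls | Neg a \<Rightarrow> Pos a \<in> set ls)" for l
      by (cases l) auto
    then show ?thesis
      by (force simp: consistent_def pos_atoms_def neg_atoms_def split: literal.splits)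
  qed
  finally show ?thesis .
qed

lemma positive_proc: "set (val (positive_proc ls)) = pos_atoms (set ls)"
  unfolding positive_proc_def
  by (rule loop_invariant[where I = "\<lambda>ls M. set M = pos_atoms (set ls)"])
    (auto simp: pos_atoms_def split: literal.splits)

lemma program_of_Nil [simp]: "program_of [] = {}"
  and program_of_Cons [simp]: "program_of ((h, B) # cs) = insert (Clause h (set B)) (program_of cs)"
  and program_of_append [simp]: "program_of (cs @ cs') = program_of cs \<union> program_of cs'"
  by (auto simp: program_of_def)

lemma Collect_insert:
  "{f c | c. c \<in> insert x P \<and> Q c} = {f c | c. c \<in> P \<and> Q c} \<union> (if Q x then {f x} else {})"
  by auto

lemma residual_proc: "program_of (val (residual_proc cs ls)) = residual (program_of cs) (set ls)"
proof -
  let ?L = "set ls"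
  have inner: "val (loop (\<lambda>l (keep, B'). ret (keep \<and> dual l \<notin> ?L, if l \<in> ?L then B' else l # B'))
      B (keep, [])) = (keep \<and> (\<forall>l\<in>set B. dual l \<notin> ?L), rev (filter (\<lambda>l. l \<notin> ?L) B))" for B keep
    by (rule loop_invariant[where I = "\<lambda>B r.
          r = (keep \<and> (\<forall>l\<in>set B. dual l \<notin> ?L), rev (filter (\<lambda>l. l \<notin> ?L) B))"]) auto
  have dual: "(\<forall>l\<in>B. dual l \<notin> ?L) \<longleftrightarrow>
      pos_atoms B \<inter> neg_atoms ?L = {} \<and> neg_atoms B \<inter> pos_atoms ?L = {}" for B
  proof -
    have "(\<forall>l\<in>B. dual l \<notin> ?L) \<longleftrightarrow> (\<forall>a. Pos a \<in> B \<longrightarrow> Neg a \<notin> ?L) \<and> (\<forall>a. Neg a \<in> B \<longrightarrow> Pos a \<notin> ?L)"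
      by (metis dual.simps literal.exhaust)
    then show ?thesis by (auto simp: pos_atoms_def neg_atoms_def)
  qed
  have single: "residual (insert (Clause h B) P) ?L = residual P ?L \<union>
      (if (case h of None \<Rightarrow> True | Some p \<Rightarrow> Pos p \<notin> ?L \<and> Neg p \<notin> ?L) \<and> (\<forall>l\<in>B. dual l \<notin> ?L)
       then {Clause h (B - ?L)} else {})" for h B P
    unfolding dual residual_def Collect_insert
    by (cases h) (simp_all add: pos_atoms_def neg_atoms_def)
  show ?thesis
    unfolding residual_proc_def val_simps mark_proc
    by (rule loop_invariant[where I = "\<lambda>cs acc. program_of acc = residual (program_of cs) ?L"])
      (auto simp: inner single set_diff_eq residual_def[of "{}"] split: if_splits)
qed

lemma residual_proc_Nil: "val (residual_proc cs ls) = [] \<longleftrightarrow> residual (program_of cs) (set ls) = {}"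
  unfolding residual_proc[symmetric] by (auto simp: program_of_def)

text \<open>The program written as a list of pairs by \<^const>\<open>reduct_proc\<close>.\<close>

definition positive_program :: "('a \<times> 'a list) list \<Rightarrow> 'a program" where
  "positive_program R = (\<lambda>(p, ps). Clause (Some p) (Pos ` set ps)) ` set R"

lemma reduct_proc:
  assumes "val (reduct_proc (\<lambda>a. a \<in> M) cs) = (ok, R)"
  shows "ok \<longleftrightarrow> (\<forall>c\<in>program_of cs. head c = None \<longrightarrow> satisfies M c)"
    and "positive_program R = reduct (program_of cs) M"
proof -
  define scan where "scan B = val (loop (\<lambda>l (blocked, sat, ps). ret (case l of
            Pos a \<Rightarrow> (blocked, sat \<and> a \<in> M, a # ps)
          | Neg a \<Rightarrow> (blocked \<or> a \<in> M, sat, ps))) B (False, True, []))" for B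
  have inner: "\<exists>ps. set ps = pos_atoms (set B) \<and>
      scan B = (neg_atoms (set B) \<inter> M \<noteq> {}, pos_atoms (set B) \<subseteq> M, ps)" for B
    unfolding scan_def
    by (rule loop_invariant[where I = "\<lambda>B r. \<exists>ps. set ps = pos_atoms (set B) \<and>
          r = (neg_atoms (set B) \<inter> M \<noteq> {}, pos_atoms (set B) \<subseteq> M, ps)"])
      (auto simp: pos_atoms_def neg_atoms_def split: literal.splits)
  have "(\<lambda>(ok, R). (ok \<longleftrightarrow> (\<forall>c\<in>program_of cs. head c = None \<longrightarrow> satisfies M c)) \<and>
      positive_program R = reduct (program_of cs) M) (val (reduct_proc (\<lambda>a. a \<in> M) cs))"
    unfolding reduct_proc_def
  proof (rule loop_invariant, goal_cases)
    case 1
    then show ?case by (auto simp: positive_program_def reduct_def)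
  next
    case (2 xs x s)
    obtain h B ok R where [simp]: "x = (h, B)" "s = (ok, R)" by fastforce
    obtain ps where ps: "set ps = pos_atoms (set B)"
      "scan B = (neg_atoms (set B) \<inter> M \<noteq> {}, pos_atoms (set B) \<subseteq> M, ps)"
      using inner by blast
    have "reduct (insert (Clause h C) P) M = reduct P M \<union>
        (if h \<noteq> None \<and> neg_atoms C \<inter> M = {} then {Clause h (Pos ` pos_atoms C)} else {})" for P C
      unfolding reduct_def Collect_insert by simp
    with 2 ps show ?case
      by (cases h) (auto simp: scan_def positive_program_def satisfies_def)
  qed
  then show "ok \<longleftrightarrow> (\<forall>c\<in>program_of cs. head c = None \<longrightarrow> satisfies M c)"
    and "positive_program R = reduct (program_of cs) M"
    by (simp_all add: assms)
qed

lemma index_proc: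
  assumes "val (index_proc R) = (k, cnt, hds, occ, wl)"
  shows "\<And>i. i < length R \<Longrightarrow> cnt i = length (snd (R ! i)) \<and> hds i = fst (R ! i)"
    and "\<And>i a. count_list (occ a) i = (if i < length R then count_list (snd (R ! i)) a else 0)"
    and "set wl = (\<lambda>i. fst (R ! i)) ` {i. i < length R \<and> snd (R ! i) = []}"
    and "length wl = card {i. i < length R \<and> snd (R ! i) = []}"
proof -
  have count: "count_list (replicate n k) i = (if i = k then n else 0)" for n k i :: nat
    by (induction n) auto
  have inner: "val (loop (\<lambda>a (n, occ). ret (Suc n, occ(a := k # occ a))) ps (0, occ)) =
      (length ps, \<lambda>a. replicate (count_list ps a) k @ occ a)"
    for ps :: "'a list" and k :: nat and occ
    by (rule loop_invariant[where I = "\<lambda>ps r.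
          r = (length ps, \<lambda>a. replicate (count_list ps a) k @ occ a)"]) (auto simp: fun_eq_iff)
  have "(\<lambda>(k, cnt, hds, occ, wl). k = length R \<and>
      (\<forall>i<k. cnt i = length (snd (R ! i)) \<and> hds i = fst (R ! i)) \<and>
      (\<forall>i a. count_list (occ a) i = (if i < k then count_list (snd (R ! i)) a else 0)) \<and>
      set wl = (\<lambda>i. fst (R ! i)) ` {i. i < k \<and> snd (R ! i) = []} \<and>
      length wl = card {i. i < k \<and> snd (R ! i) = []}) (val (index_proc R))"
    unfolding index_proc_def
  proof (rule loop_invariant, goal_cases)
    case 1
    then show ?case by simp
  next
    case (2 xs x s)
    obtain k cnt hds occ wl where [simp]: "s = (k, cnt, hds, occ, wl)" by (metis prod_cases5)
    obtain p ps where [simp]: "x = (p, ps)" by fastforce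
    have nth: "(xs @ [(p, ps)]) ! i = (if i < length xs then xs ! i else (p, ps))"
      if "i < Suc (length xs)" for i
      using that by (auto simp: nth_append less_Suc_eq)
    have eq: "{i. i < Suc (length xs) \<and> snd ((xs @ [(p, ps)]) ! i) = []} =
        {i. i < length xs \<and> snd (xs ! i) = []} \<union> (if ps = [] then {length xs} else {})"
      by (auto simp: nth_append less_Suc_eq)
    have eq': "(\<lambda>i. fst ((xs @ [(p, ps)]) ! i)) ` {i. i < length xs \<and> snd (xs ! i) = []} =
        (\<lambda>i. fst (xs ! i)) ` {i. i < length xs \<and> snd (xs ! i) = []}"
      by (intro image_cong) (auto simp: nth_append)
    from 2 show ?case
      by (auto simp: inner nth eq eq' count image_Un)
  qed
  then show "\<And>i. i < length R \<Longrightarrow> cnt i = length (snd (R ! i)) \<and> hds i = fst (R ! i)"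
    and "\<And>i a. count_list (occ a) i = (if i < length R then count_list (snd (R ! i)) a else 0)"
    and "set wl = (\<lambda>i. fst (R ! i)) ` {i. i < length R \<and> snd (R ! i) = []}"
    and "length wl = card {i. i < length R \<and> snd (R ! i) = []}"
    by (simp_all add: assms)
qed

lemma countdown:
  assumes "\<And>i. count_list js i \<le> cnt i"
    and "val (loop (\<lambda>i (cnt, wl). ret (cnt(i := cnt i - 1), if cnt i = 1 then hds i # wl else wl))
           js (cnt, wl)) = (cnt', wl')"
  defines "S \<equiv> {i. cnt i \<noteq> 0 \<and> cnt i = count_list js i}"
  shows "cnt' = (\<lambda>i. cnt i - count_list js i)"
    and "set wl' = set wl \<union> hds ` S"
    and "length wl' = length wl + card S"
proof -
  have "cnt' = (\<lambda>i. cnt i - count_list js i) \<and> set wl' = set wl \<union> hds ` S \<and>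
      length wl' = length wl + card S"
    using assms(1,2) unfolding S_def
  proof (induction js arbitrary: cnt wl)
    case Nil
    have "{i. cnt i \<noteq> 0 \<and> cnt i = count_list [] i} = {}" by auto
    with Nil show ?case by (simp only: loop.simps val_simps prod.inject) simp
  next
    case (Cons j js)
    let ?cnt = "cnt(j := cnt j - 1)"
    let ?S = "{i. cnt i \<noteq> 0 \<and> cnt i = count_list (j # js) i}"
    let ?S' = "{i. ?cnt i \<noteq> 0 \<and> ?cnt i = count_list js i}"
    have le: "count_list js i \<le> ?cnt i" for i
      using Cons.prems(1)[of i] by (auto split: if_splits)
    have "?S' \<subseteq> set js"
      by (auto intro: ccontr simp: count_list_0_iff)
    then have fin: "finite ?S'" by (rule finite_subset) simp
    have j: "cnt j \<noteq> 0" "count_list js j \<le> cnt j - 1" using Cons.prems(1)[of j] by auto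
    have "val (loop (\<lambda>i (cnt, wl). ret (cnt(i := cnt i - 1), if cnt i = 1 then hds i # wl else wl))
            js (?cnt, if cnt j = 1 then hds j # wl else wl)) = (cnt', wl')"
      using Cons.prems(2) by (simp only: loop.simps val_simps prod.case)
    note IH = Cons.IH[OF le this]
    have "(\<lambda>i. ?cnt i - count_list js i) = (\<lambda>i. cnt i - count_list (j # js) i)"
      by (auto simp: fun_eq_iff)
    with IH have cnt': "cnt' = (\<lambda>i. cnt i - count_list (j # js) i)" by simp
    show ?case
    proof (cases "cnt j = 1")
      case True
      then have S: "?S = insert j ?S'" "j \<notin> ?S'" using j by auto
      show ?thesis
        unfolding S(1) card_insert_disjoint[OF fin S(2)] using IH True cnt' by simp
    next
      case False
      then have S: "?S = ?S'" using j by auto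
      show ?thesis
        unfolding S using IH False cnt' by simp
    qed
  qed
  then show "cnt' = (\<lambda>i. cnt i - count_list js i)" "set wl' = set wl \<union> hds ` S"
    "length wl' = length wl + card S" by auto
qed

lemma length_filter_not_upd:
  "\<not> der a \<Longrightarrow> length (filter (\<lambda>x. \<not> (der(a := True)) x) ps) =
     length (filter (\<lambda>x. \<not> der x) ps) - count_list ps a"
  "\<not> der a \<Longrightarrow> count_list ps a \<le> length (filter (\<lambda>x. \<not> der x) ps)"
proof -
  assume "\<not> der a"
  then have "length (filter (\<lambda>x. \<not> (der(a := True)) x) ps) + count_list ps a =
     length (filter (\<lambda>x. \<not> der x) ps)"
    by (induction ps) auto
  then show "length (filter (\<lambda>x. \<not> (der(a := True)) x) ps) =
     length (filter (\<lambda>x. \<not> der x) ps) - count_list ps a"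
    "count_list ps a \<le> length (filter (\<lambda>x. \<not> der x) ps)" by linarith+
qed

lemma is_model_positive_program:
  "is_model (positive_program R) N \<longleftrightarrow>
     (\<forall>i<length R. set (snd (R ! i)) \<subseteq> N \<longrightarrow> fst (R ! i) \<in> N)"
proof -
  have "is_model (positive_program R) N \<longleftrightarrow> (\<forall>r\<in>set R. set (snd r) \<subseteq> N \<longrightarrow> fst r \<in> N)"
    by (auto simp: is_model_def positive_program_def satisfies_def pos_atoms_def neg_atoms_def
      image_iff subset_iff)
  then show ?thesis by (simp add: all_set_conv_all_nth)
qed

lemma least_model_proc:
  assumes "val (least_model_proc R) = (D, der)"
  shows "set D = Collect der" and "is_least_model (positive_program R) (set D)"
proof -
  let ?k = "length R"
  obtain k cnt hds occ wl where ix: "val (index_proc R) = (k, cnt, hds, occ, wl)"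
    by (metis prod_cases5)
  note index = index_proc[OF ix]
  define open_pos where "open_pos der i = length (filter (\<lambda>x. \<not> der x) (snd (R ! i)))" for der i
  define I :: "nat \<Rightarrow> 'a list \<times> ('a \<Rightarrow> bool) \<times> (nat \<Rightarrow> nat) \<times> 'a list \<Rightarrow> bool" where
    "I r = (\<lambda>(D, der, cnt, wl). set D = Collect der \<and>
       (\<forall>i<?k. cnt i = open_pos der i) \<and>
       (\<forall>N. is_model (positive_program R) N \<longrightarrow> Collect der \<union> set wl \<subseteq> N) \<and>
       (\<forall>i<?k. cnt i = 0 \<longrightarrow> fst (R ! i) \<in> set wl \<or> der (fst (R ! i))) \<and>
       (wl = [] \<or> length wl + card {i. i < ?k \<and> cnt i \<noteq> 0} \<le> r))" for r
  define f where "f = (\<lambda>(_ :: 'a \<times> 'a list) (D, der, cnt :: nat \<Rightarrow> nat, wl). case wl of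
         [] \<Rightarrow> ret (D, der, cnt, wl)
       | a # wl' \<Rightarrow>
           if der a then ret (D, der, cnt, wl')
           else loop (\<lambda>i (cnt, wl).
                  ret (cnt(i := cnt i - 1), if cnt i = 1 then hds i # wl else wl))
                (occ a) (cnt, wl') \<bind> (\<lambda>(cnt, wl). ret (a # D, der(a := True), cnt, wl)))"
  have init: "I ?k ([], \<lambda>_. False, cnt, wl)"
  proof -
    have "{i. i < ?k \<and> snd (R ! i) = []} \<union> {i. i < ?k \<and> cnt i \<noteq> 0} = {..<?k}"
      using index(1) by auto
    moreover have "{i. i < ?k \<and> snd (R ! i) = []} \<inter> {i. i < ?k \<and> cnt i \<noteq> 0} = {}"
      using index(1) by auto
    ultimately have "length wl + card {i. i < ?k \<and> cnt i \<noteq> 0} = ?k"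
      unfolding index(4) by (subst card_Un_disjoint[symmetric]) auto
    then show ?thesis
      using index(1,3) by (auto simp: I_def open_pos_def is_model_positive_program)
  qed
  have step: "I (r - 1) (val (f x s))" if "I r s" for r x s
  proof -
    obtain D der cnt wl where s: "s = (D, der, cnt, wl)" by (metis prod_cases4)
    note I = that[unfolded I_def s prod.case]
    consider "wl = []" | a wl' where "wl = a # wl'" "der a" | a wl' where "wl = a # wl'" "\<not> der a"
      by (cases wl) auto
    then show ?thesis
    proof cases
      case 1
      with I show ?thesis by (auto simp: I_def f_def s)
    next
      case 2
      with I show ?thesis by (auto simp: I_def f_def s)
    next
      case (3 a wl')
      have le: "count_list (occ a) i \<le> cnt i" for i
        using I 3 length_filter_not_upd(2)[of der a "snd (R ! i)"]
        by (auto simp: index(2) open_pos_def)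
      obtain cnt2 wl2 where lp: "val (loop (\<lambda>i (cnt, wl).
          ret (cnt(i := cnt i - 1), if cnt i = 1 then hds i # wl else wl)) (occ a) (cnt, wl')) =
          (cnt2, wl2)" by fastforce
      let ?S = "{i. cnt i \<noteq> 0 \<and> cnt i = count_list (occ a) i}"
      note cd = countdown[OF le lp]
      let ?der = "der(a := True)"
      have S: "i < ?k" if "i \<in> ?S" for i
        using that index(2)[of a i] by (auto split: if_splits)
      have cnt2: "cnt2 i = open_pos ?der i" if "i < ?k" for i
        using that I 3 length_filter_not_upd(1)[of der a "snd (R ! i)"]
        by (auto simp: cd(1) index(2) open_pos_def)
      have S_iff: "i \<in> ?S \<longleftrightarrow> cnt i \<noteq> 0 \<and> cnt2 i = 0" for i
        using le[of i] by (auto simp: cd(1))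
      have sound: "Collect ?der \<union> set wl2 \<subseteq> N" if N: "is_model (positive_program R) N" for N
      proof -
        have "Collect der \<union> set wl \<subseteq> N" using I N by blast
        then have *: "Collect ?der \<subseteq> N" "set wl' \<subseteq> N" using 3 by (auto simp: subset_iff split: if_splits)
        moreover have "hds i \<in> N" if "i \<in> ?S" for i
        proof -
          have i: "i < ?k" using S that .
          have "open_pos ?der i = 0" using that S_iff cnt2[OF i] by auto
          then have "set (snd (R ! i)) \<subseteq> Collect ?der"
            unfolding open_pos_def by (auto simp: filter_empty_conv)
          then show ?thesis
            using N * i index(1)[OF i] by (auto simp: is_model_positive_program)
        qed
        ultimately show ?thesis unfolding cd(2) by auto
      qed
      have closed: "fst (R ! i) \<in> set wl2 \<or> ?der (fst (R ! i))" if "i < ?k" "cnt2 i = 0" for i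
      proof (cases "cnt i = 0")
        case True
        with I that 3 show ?thesis unfolding cd(2) by auto
      next
        case False
        with that S_iff have "i \<in> ?S" by auto
        then have "hds i \<in> set wl2" unfolding cd(2) by blast
        with that index(1) show ?thesis by auto
      qed
      have "{i. i < ?k \<and> cnt i \<noteq> 0} = ?S \<union> {i. i < ?k \<and> cnt2 i \<noteq> 0}"
        using S S_iff by (auto simp: cd(1))
      moreover have "?S \<inter> {i. i < ?k \<and> cnt2 i \<noteq> 0} = {}"
        using S_iff by auto
      moreover have "finite ?S" by (rule finite_subset[of _ "{..<?k}"]) (use S in auto)
      ultimately have "card {i. i < ?k \<and> cnt i \<noteq> 0} = card ?S + card {i. i < ?k \<and> cnt2 i \<noteq> 0}"
        by (simp add: card_Un_disjoint)
      then have bound: "length wl2 + card {i. i < ?k \<and> cnt2 i \<noteq> 0} \<le> r - 1"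
        using I 3 cd(3) by auto
      have "val (f x s) = (a # D, ?der, cnt2, wl2)"
        using 3 lp by (simp add: f_def s)
      moreover have "set (a # D) = Collect ?der" using I by auto
      ultimately show ?thesis
        using cnt2 sound closed bound unfolding I_def by simp
    qed
  qed
  have all: "I (?k - length xs) (val (loop f xs ([], \<lambda>_. False, cnt, wl)))" for xs
  proof (rule loop_invariant[where I = "\<lambda>xs. I (?k - length xs)"])
    show "I (?k - length []) ([], \<lambda>_. False, cnt, wl)" using init by simp
    show "I (?k - length (xs @ [x])) (val (f x s))" if "I (?k - length xs) s" for xs x s
      using step[OF that] by simp
  qed
  obtain D' der' cnt' wl' where
    res: "val (loop f R ([], \<lambda>_. False, cnt, wl)) = (D', der', cnt', wl')"
    by (metis prod_cases4)
  have "val (least_model_proc R) = (D', der')"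
    using ix res by (simp add: least_model_proc_def f_def)
  with assms have eq: "D' = D" "der' = der" by auto
  note I = all[of R, unfolded res eq I_def prod.case]
  have wl': "wl' = []" using conjunct2[OF conjunct2[OF conjunct2[OF conjunct2[OF I]]]] by auto
  show *: "set D = Collect der" by (rule conjunct1[OF I])
  have sound: "Collect der \<subseteq> N" if "is_model (positive_program R) N" for N
    using I that by blast
  have "der (fst (R ! i))" if i: "i < ?k" and sub: "set (snd (R ! i)) \<subseteq> Collect der" for i
  proof -
    have "open_pos der i = 0" using sub by (auto simp: open_pos_def filter_empty_conv)
    with I i have "fst (R ! i) \<in> set wl' \<or> der (fst (R ! i))" by metis
    then show ?thesis by (simp add: wl')
  qed
  then have "is_model (positive_program R) (Collect der)"
    by (simp add: is_model_positive_program)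
  with sound show "is_least_model (positive_program R) (set D)"
    unfolding * is_least_model_def by blast
qed

lemma stable_check_proc:
  assumes "set M \<subseteq> At (program_of cs)"
  shows "val (stable_check_proc cs M) \<longleftrightarrow> stable_model (program_of cs) (set M)"
proof -
  obtain ok R where R: "val (reduct_proc (\<lambda>a. a \<in> set M) cs) = (ok, R)" by fastforce
  obtain D der where D: "val (least_model_proc R) = (D, der)" by fastforce
  have all: "val (loop (\<lambda>a b. ret (b \<and> p a)) xs True) \<longleftrightarrow> (\<forall>a\<in>set xs. p a)" for p :: "'a \<Rightarrow> bool" and xs
    by (rule loop_invariant[where I = "\<lambda>xs b. b \<longleftrightarrow> (\<forall>a\<in>set xs. p a)"]) auto
  have der: "der = (\<lambda>a. a \<in> set D)" using least_model_proc(1)[OF D] by auto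
  have "val (stable_check_proc cs M) \<longleftrightarrow> ok \<and> set D = set M"
    by (auto simp: stable_check_proc_def mark_proc R D all der)
  moreover have "is_least_model (reduct (program_of cs) (set M)) N \<longleftrightarrow> N = set D" for N
    using least_model_proc(2)[OF D] unfolding reduct_proc(2)[OF R]
    by (auto simp: is_least_model_def)
  ultimately show ?thesis
    using assms reduct_proc(1)[OF R] by (auto simp: stable_model_def)
qed

lemma stable_proc_dom:
  assumes c: "\<And>Q. finite_program Q \<Longrightarrow> definite Q \<Longrightarrow> Q \<noteq> {} \<Longrightarrow>
      complete_for Q (set ` set (val (c Q)))"
    and P: "definite (program_of cs)"
  shows "stable_proc_dom (c, cs, ls, out)"
proof (induction "card (Lit (program_of cs) - set ls)" arbitrary: ls out rule: less_induct)
  case less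
  let ?P = "program_of cs"
  have fin: "finite_program ?P" by (auto simp: finite_program_def program_of_def)
  note residual = residual_program[OF fin P, of "set ls"]
  show ?case
  proof (rule stable_proc.domintros)
    fix A out'
    assume "val (residual_proc cs ls) \<noteq> []"
      and A: "A \<in> set (val (c (program_of (val (residual_proc cs ls)))))"
    then have ne: "residual ?P (set ls) \<noteq> {}"
      by (simp add: residual_proc_Nil)
    show "stable_proc_dom (c, cs, val (loop (\<lambda>l ls'. ret (l # ls')) A ls), out')"
      by (rule less, unfold set_loop_Cons, rule complete_decreases[OF fin c[OF residual ne]])
        (use A in \<open>simp add: residual_proc\<close>)
  qed
qed

lemma stable_proc_eq:
  assumes "\<And>Q. finite_program Q \<Longrightarrow> definite Q \<Longrightarrow> Q \<noteq> {} \<Longrightarrow>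
      complete_for Q (set ` set (val (c Q)))"
    and "definite (program_of cs)"
  shows "stable_proc c cs ls out =
     consistent_proc ls \<bind> (\<lambda>ok.
     if \<not> ok then ret out
     else residual_proc cs ls \<bind> (\<lambda>qs.
       if qs = [] then
         positive_proc ls \<bind> (\<lambda>M.
         stable_check_proc cs M \<bind> (\<lambda>b.
         ret (if b then M # out else out)))
       else
         c (program_of qs) \<bind> (\<lambda>As.
         loop (\<lambda>A out.
           loop (\<lambda>l ls'. ret (l # ls')) A ls \<bind> (\<lambda>ls'.
           stable_proc c cs ls' out)) As out)))"
  by (rule stable_proc.psimps, rule stable_proc_dom) (use assms in auto)

end

theory Submission
  imports Defs
begin

text \<open>With \<open>D = O(t(m) + m)\<close> bounding the cost of one call without its recursive calls, plus the
  cost of extending \<open>L\<close> for one recursive call, the total is at most \<open>D\<close> times the number of nodes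
  and edges of the recursion tree. The tree has \<open>s(P,L)\<close> leaves, and since inner nodes have
  at least two children it has fewer inner nodes than leaves. The check of stability is linear
  because the occurrence list of an atom is scanned only when that atom is first derived, so all
  these scans together are at most as long as the program.\<close>

section \<open>Running times of the subroutines\<close>

lemma steps_simps [simp]: "steps (ret x) = 1" "steps (m \<bind> f) = steps m + steps (f (val m))"
  by (simp_all add: ret_def bind_def)

text \<open>Amortized cost: \<open>g x\<close> is charged for the round of \<open>x\<close>, and \<open>\<Psi>\<close> pays for the rest.\<close>

lemma loop_steps:
  assumes "I s"
    and "\<And>x s. x \<in> set xs \<Longrightarrow> I s \<Longrightarrow>
      I (val (f x s)) \<and> \<Psi> s + steps (f x s) \<le> \<Psi> (val (f x s)) + g x"
  shows "I (val (loop f xs s)) \<and>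
    \<Psi> s + steps (loop f xs s) \<le> \<Psi> (val (loop f xs s)) + 1 + (\<Sum>x\<leftarrow>xs. Suc (g x))"
  using assms
proof (induction xs arbitrary: s)
  case Nil
  then show ?case by simp
next
  case (Cons x xs)
  have x: "I (val (f x s))" "\<Psi> s + steps (f x s) \<le> \<Psi> (val (f x s)) + g x"
    using Cons.prems by auto
  show ?case
    using Cons.IH[OF x(1)] Cons.prems(2) x(2) by fastforce
qed

lemma loop_steps_le:
  assumes "\<And>x s. x \<in> set xs \<Longrightarrow> steps (f x s) \<le> g x"
  shows "steps (loop f xs s) \<le> 1 + (\<Sum>x\<leftarrow>xs. Suc (g x))"
  using loop_steps[where I = "\<lambda>_. True" and \<Psi> = "\<lambda>_. 0" and xs = xs and f = f and g = g] assms
  by auto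

lemma loop_steps_const:
  assumes "\<And>x s. steps (f x s) = 1"
  shows "steps (loop f xs s) = 1 + 2 * length xs"
  by (induction xs arbitrary: s) (auto simp: assms)

section \<open>Linear passes over literals and clauses\<close>

lemma mark_proc_steps: "steps (mark_proc xs) = 1 + 2 * length xs"
  by (simp add: mark_proc_def loop_steps_const)

lemma consistent_proc_steps: "steps (consistent_proc ls) = 2 + 4 * length ls"
  by (simp add: consistent_proc_def mark_proc_steps loop_steps_const)

lemma positive_proc_steps: "steps (positive_proc ls) = 1 + 2 * length ls"
  by (simp add: positive_proc_def loop_steps_const)

lemma length_positive_proc: "length (val (positive_proc ls)) \<le> length ls"
  unfolding positive_proc_def
  by (rule loop_invariant[where I = "\<lambda>ls M. length M \<le> length ls"]) (auto split: literal.splits)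

text \<open>The 1 per pair counts the head, also for \<open>None\<close>, so that
  \<open>list_size\<close> bounds the number of clauses as well.\<close>

definition list_size :: "('b \<times> 'c list) list \<Rightarrow> nat" where
  "list_size xs = (\<Sum>(x, ys)\<leftarrow>xs. 1 + length ys)"

lemma list_size_simps [simp]:
  "list_size [] = 0" "list_size ((x, ys) # xs) = 1 + length ys + list_size xs"
  "list_size (xs @ xs') = list_size xs + list_size xs'"
  by (simp_all add: list_size_def)

lemma length_le_list_size: "length xs \<le> list_size xs"
  by (induction xs) auto

text \<open>With the loop's own step a round costs at most \<open>4 + 2 * length B\<close>, which is
  at most 4 times the share \<open>1 + length B\<close> of its clause.\<close>

lemma loop_steps_list_size:
  assumes "\<And>h B s. steps (f (h, B) s) \<le> 3 + 2 * length B"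
  shows "steps (loop f cs s) \<le> 1 + 4 * list_size cs"
proof -
  have "(\<Sum>(h, B)\<leftarrow>cs. Suc (3 + 2 * length B)) \<le> 4 * list_size cs"
    by (induction cs) auto
  moreover have "steps (loop f cs s) \<le> 1 + (\<Sum>x\<leftarrow>cs. Suc (3 + 2 * length (snd x)))"
    by (rule loop_steps_le) (use assms in auto)
  ultimately show ?thesis by (simp add: case_prod_unfold)
qed

lemma residual_proc_steps:
  "steps (residual_proc cs ls) \<le> 2 + 2 * length ls + 4 * list_size cs"
proof -
  have "steps (residual_proc cs ls) \<le> (1 + 2 * length ls) + (1 + 4 * list_size cs)"
    unfolding residual_proc_def steps_simps mark_proc_steps
    by (intro add_left_mono loop_steps_list_size)
      (auto simp: loop_steps_const case_prod_unfold)
  then show ?thesis by simp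
qed

lemma reduct_proc_steps: "steps (reduct_proc tab cs) \<le> 1 + 4 * list_size cs"
  unfolding reduct_proc_def
  by (rule loop_steps_list_size) (auto simp: loop_steps_const case_prod_unfold)

text \<open>Each clause contributes at most one clause, with a body no longer than before. Hence
  bounds in terms of the reduct are bounds in terms of \<open>cs\<close>.\<close>

lemma reduct_proc_size:
  assumes "val (reduct_proc tab cs) = (ok, R)"
  shows "list_size R \<le> list_size cs"
proof -
  have inner: "length (snd (snd (val (loop (\<lambda>l (blocked, sat, ps). ret (case l of
            Pos a \<Rightarrow> (blocked, sat \<and> tab a, a # ps)
          | Neg a \<Rightarrow> (blocked \<or> tab a, sat, ps))) B (False, True, []))))) \<le> length B" for B
    by (rule loop_invariant[where I = "\<lambda>B s. length (snd (snd s)) \<le> length B"])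
      (auto split: literal.splits)
  have "list_size (snd (val (reduct_proc tab cs))) \<le> list_size cs"
    unfolding reduct_proc_def
  proof (rule loop_invariant[where I = "\<lambda>cs s. list_size (snd s) \<le> list_size cs"], goal_cases)
    case 1
    then show ?case by simp
  next
    case (2 xs x s)
    with inner[of "snd x"] show ?case
      by (cases x) (auto simp: case_prod_unfold split: option.splits)
  qed
  with assms show ?thesis by simp
qed

section \<open>Least models and the stability check\<close>

lemma index_proc_steps: "steps (index_proc R) \<le> 1 + 4 * list_size R"
  unfolding index_proc_def
  by (rule loop_steps_list_size) (auto simp: loop_steps_const case_prod_unfold)

text \<open>Every occurrence of an atom in a body pushes one entry onto one occurrence list. The set
  \<open>A\<close> will be the set of derived atoms.\<close>

lemma index_proc_occ:
  assumes "val (index_proc R) = (k, cnt, hds, occ, wl)" and "finite A"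
  shows "(\<Sum>a\<in>A. length (occ a)) \<le> list_size R"
proof -
  have upd: "(\<Sum>a\<in>A. length ((occ(b := k # occ b)) a)) \<le> Suc (\<Sum>a\<in>A. length (occ a))"
    for occ :: "'a \<Rightarrow> nat list" and b k
  proof (cases "b \<in> A")
    case True
    have "(\<Sum>a\<in>A - {b}. length ((occ(b := k # occ b)) a)) = (\<Sum>a\<in>A - {b}. length (occ a))"
      by (rule sum.cong) auto
    then show ?thesis
      using \<open>finite A\<close> True by (simp add: sum.remove[of A b])
  next
    case False
    then have "(\<Sum>a\<in>A. length ((occ(b := k # occ b)) a)) = (\<Sum>a\<in>A. length (occ a))"
      by (intro sum.cong) auto
    then show ?thesis by simp
  qed
  have inner: "(\<Sum>a\<in>A. length (snd (val
      (loop (\<lambda>a (n, occ). ret (Suc n, occ(a := k # occ a))) ps (0, occ))) a))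
      \<le> (\<Sum>a\<in>A. length (occ a)) + length ps" for ps :: "'a list" and k :: nat and occ
  proof (rule loop_invariant[where
        I = "\<lambda>ps s. (\<Sum>a\<in>A. length (snd s a)) \<le> (\<Sum>a\<in>A. length (occ a)) + length ps"], goal_cases)
    case 1
    then show ?case by simp
  next
    case (2 xs x s)
    with upd[of "snd s" x k] show ?case by (simp add: case_prod_unfold)
  qed
  have "(\<lambda>(k, cnt, hds, occ, wl). (\<Sum>a\<in>A. length (occ a)) \<le> list_size R) (val (index_proc R))"
    unfolding index_proc_def
  proof (rule loop_invariant[where
        I = "\<lambda>R (k, cnt, hds, occ, wl). (\<Sum>a\<in>A. length (occ a)) \<le> list_size R"], goal_cases)
    case 1
    then show ?case by simp
  next
    case (2 xs x s)
    obtain k cnt hds occ wl where s: "s = (k, cnt, hds, occ, wl)" by (metis prod_cases5)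
    obtain p ps where x: "x = (p, ps)" by fastforce
    from 2 inner[of k ps occ] show ?case by (simp add: s x case_prod_unfold)
  qed
  with assms show ?thesis by simp
qed

text \<open>A round that derives \<open>a\<close> takes \<open>2 + 2 * length (occ a)\<close> steps.
  The 2 is charged to the round and the rest to the growth of \<open>\<Psi>\<close>; every other
  round takes one step. The final value of \<open>\<Psi>\<close> is bounded by the total length of
  the occurrence lists.\<close>

lemma least_model_proc_steps:
  assumes "val (least_model_proc R) = (D, der)"
  shows "steps (least_model_proc R) \<le> 3 + 9 * list_size R" and "length D \<le> length R"
proof -
  obtain k cnt hds occ wl where ix: "val (index_proc R) = (k, cnt, hds, occ, wl)"
    by (metis prod_cases5)
  define f where "f = (\<lambda>(_ :: 'a \<times> 'a list) (D, der, cnt :: nat \<Rightarrow> nat, wl). case wl of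
         [] \<Rightarrow> ret (D, der, cnt, wl)
       | a # wl' \<Rightarrow>
           if der a then ret (D, der, cnt, wl')
           else loop (\<lambda>i (cnt, wl).
                  ret (cnt(i := cnt i - 1), if cnt i = 1 then hds i # wl else wl))
                (occ a) (cnt, wl') \<bind> (\<lambda>(cnt, wl). ret (a # D, der(a := True), cnt, wl)))"
  define s0 where "s0 = ([] :: 'a list, \<lambda>_ :: 'a. False, cnt, wl)"
  define res where "res = val (loop f R s0)"
  have eq: "least_model_proc R = index_proc R \<bind> (\<lambda>_. loop f R s0 \<bind> (\<lambda>(D, der, cnt, wl). ret (D, der)))"
    by (simp add: least_model_proc_def bind_def ix f_def s0_def)
  have D: "fst res = D"
    using assms by (simp add: eq res_def case_prod_unfold)
  \<comment> \<open>The invariant ensures that an atom with \<open>der a\<close> false is new to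
    \<open>D\<close>, so that \<open>\<Psi>\<close> grows by the full
    \<open>2 * length (occ a)\<close>.\<close>
  define I :: "'a list \<times> ('a \<Rightarrow> bool) \<times> (nat \<Rightarrow> nat) \<times> 'a list \<Rightarrow> bool" where
    "I = (\<lambda>s. distinct (fst s) \<and> set (fst s) = Collect (fst (snd s)))"
  define \<Psi> :: "'a list \<times> ('a \<Rightarrow> bool) \<times> (nat \<Rightarrow> nat) \<times> 'a list \<Rightarrow> nat" where
    "\<Psi> = (\<lambda>s. 2 * (\<Sum>a\<in>set (fst s). length (occ a)))"
  have "I res \<and> \<Psi> s0 + steps (loop f R s0) \<le> \<Psi> res + 1 + (\<Sum>x\<leftarrow>R. Suc 2)"
    unfolding res_def
  proof (rule loop_steps)
    show "I s0" by (simp add: I_def s0_def)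
  next
    fix x s assume I: "I s"
    obtain D der cnt wl where s: "s = (D, der, cnt, wl)" by (metis prod_cases4)
    consider "wl = []" | a wl' where "wl = a # wl'" "der a" | a wl' where "wl = a # wl'" "\<not> der a"
      by (cases wl) auto
    then show "I (val (f x s)) \<and> \<Psi> s + steps (f x s) \<le> \<Psi> (val (f x s)) + 2"
    proof cases
      case (3 a wl')
      with I have "a \<notin> set D" by (auto simp: I_def s)
      moreover have "steps (f x s) = 2 + 2 * length (occ a)"
        by (simp add: f_def s 3 case_prod_unfold loop_steps_const)
      moreover have val: "fst (val (f x s)) = a # D" "fst (snd (val (f x s))) = der(a := True)"
        by (simp_all add: f_def s 3 case_prod_unfold)
      moreover have "\<Psi> (val (f x s)) = \<Psi> s + 2 * length (occ a)"
        unfolding \<Psi>_def val using \<open>a \<notin> set D\<close> by (simp add: s)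
      moreover have "I (val (f x s))"
      proof -
        have "Collect (der(a := True)) = insert a (Collect der)" by auto
        moreover have "distinct D" "set D = Collect der" using I by (simp_all add: I_def s)
        ultimately show ?thesis unfolding I_def val using \<open>a \<notin> set D\<close> by simp
      qed
      ultimately show ?thesis by simp
    qed (use I in \<open>auto simp: I_def \<Psi>_def f_def s\<close>)
  qed
  moreover have "\<Psi> s0 = 0" "\<Psi> res = 2 * (\<Sum>a\<in>set D. length (occ a))"
    by (simp_all add: \<Psi>_def D) (simp add: s0_def)
  moreover have "(\<Sum>x\<leftarrow>R. Suc 2) = 3 * length R"
    by (simp add: sum_list_triv)
  ultimately have "steps (loop f R s0) \<le> 2 * (\<Sum>a\<in>set D. length (occ a)) + 1 + 3 * length R"
    by linarith
  moreover have "(\<Sum>a\<in>set D. length (occ a)) \<le> list_size R"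
    using index_proc_occ[OF ix] by simp
  ultimately show "steps (least_model_proc R) \<le> 3 + 9 * list_size R"
    using index_proc_steps[of R] length_le_list_size[of R] by (simp add: eq case_prod_unfold)
  \<comment> \<open>A round derives at most one atom. This bounds the later loop over
    \<open>D\<close> in the stability check.\<close>
  have "length (fst res) \<le> length R"
    unfolding res_def
  proof (rule loop_invariant[where I = "\<lambda>R s. length (fst s) \<le> length R"], goal_cases)
    case 1
    then show ?case by (simp add: s0_def)
  next
    case (2 xs x s)
    then show ?case
      by (auto simp: f_def case_prod_unfold split: list.split)
  qed
  then show "length D \<le> length R" by (simp add: D)
qed

lemma stable_check_proc_steps:
  "steps (stable_check_proc cs M) \<le> 8 + 15 * list_size cs + 4 * length M"
proof -
  obtain ok R where R: "val (reduct_proc (\<lambda>a. a \<in> set M) cs) = (ok, R)" by fastforce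
  obtain D der where D: "val (least_model_proc R) = (D, der)" by fastforce
  have "steps (stable_check_proc cs M) = 4 + 4 * length M + 2 * length D +
      steps (reduct_proc (\<lambda>a. a \<in> set M) cs) + steps (least_model_proc R)"
    by (simp add: stable_check_proc_def mark_proc mark_proc_steps R D loop_steps_const)
  with least_model_proc_steps[OF D] reduct_proc_steps[of "\<lambda>a. a \<in> set M" cs]
    reduct_proc_size[OF R] length_le_list_size[of R]
  show ?thesis by linarith
qed


section \<open>Sizes of programs\<close>

text \<open>Absence of repetitions turns sums over sets of clauses and cardinalities of bodies into
  list sums and lengths; definiteness makes the 1 per clause a real head.\<close>

lemma list_size_eq_program_size:
  assumes "lists_program cs P" "definite P"
  shows "list_size cs = program_size P"
proof -
  let ?c = "\<lambda>(h, B). Clause h (set B)"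
  have "program_size P = (\<Sum>c\<leftarrow>map ?c cs. card (set_option (head c)) + card (body c))"
    using assms(1) unfolding program_size_def lists_program_def program_of_def
    by (subst sum_list_distinct_conv_sum_set) auto
  also have "\<dots> = (\<Sum>(h, B)\<leftarrow>cs. 1 + length B)"
    unfolding map_map
  proof (rule arg_cong[where f = sum_list], rule map_cong[OF refl], clarify)
    fix h B assume hB: "(h, B) \<in> set cs"
    have "Clause h (set B) \<in> P" using assms(1) hB by (force simp: lists_program_def program_of_def)
    with assms(2) obtain p where "h = Some p" by (auto simp: definite_def)
    moreover have "distinct B" using assms(1) hB by (auto simp: lists_program_def)
    ultimately show "((\<lambda>c. card (set_option (head c)) + card (body c)) \<circ> ?c) (h, B) = 1 + length B"
      by (simp add: distinct_card)
  qed
  finally show ?thesis by (simp add: list_size_def)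
qed

lemma card_At_le:
  assumes "finite_program P"
  shows "card (At P) \<le> program_size P"
proof -
  have "card (set_option (head c) \<union> pos_atoms (body c) \<union> neg_atoms (body c))
      \<le> card (set_option (head c)) + card (body c)" if "c \<in> P" for c
  proof -
    \<comment> \<open>Forgetting the sign maps the body onto its atoms.\<close>
    have "pos_atoms (body c) \<union> neg_atoms (body c) =
        (\<lambda>l. case l of Pos a \<Rightarrow> a | Neg a \<Rightarrow> a) ` body c"
      by (force simp: pos_atoms_def neg_atoms_def image_iff split: literal.splits)
    then have "card (pos_atoms (body c) \<union> neg_atoms (body c)) \<le> card (body c)"
      using assms that by (simp add: finite_program_def card_image_le)
    then show ?thesis
      using card_Un_le[of "set_option (head c)" "pos_atoms (body c) \<union> neg_atoms (body c)"]
      by (simp add: Un_assoc)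
  qed
  moreover have "card (At P) \<le>
      (\<Sum>c\<in>P. card (set_option (head c) \<union> pos_atoms (body c) \<union> neg_atoms (body c)))"
    using assms by (simp add: At_def finite_program_def card_UN_le)
  ultimately show ?thesis
    unfolding program_size_def by (meson order_trans sum_mono)
qed

lemma card_Lit_le:
  assumes "finite_program P"
  shows "card (Lit P) \<le> 2 * program_size P"
proof -
  have "finite (Pos ` At P)"
    using finite_Lit[OF assms] by (simp add: Lit_def)
  then have "finite (At P)"
    by (rule finite_imageD) (auto intro: inj_onI)
  then have "card (Lit P) \<le> card (At P) + card (At P)"
    unfolding Lit_def by (meson add_mono card_Un_le card_image_le order_trans)
  with card_At_le[OF assms] show ?thesis by simp
qed

text \<open>Applied to the literal list at a node of the recursion and to its extensions for the
  children.\<close>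

lemma length_subset_Lit_le:
  assumes "finite_program P" "distinct ls" "set ls \<subseteq> Lit P"
  shows "length ls \<le> 2 * program_size P"
  using card_mono[OF finite_Lit assms(3)] card_Lit_le[of P] assms(1,2)
  by (simp add: distinct_card)

lemma program_size_residual_le:
  assumes "finite_program P"
  shows "program_size (residual P L) \<le> program_size P"
proof -
  let ?w = "\<lambda>c. card (set_option (head c)) + card (body c)"
  let ?r = "\<lambda>c. Clause (head c) (body c - L)"
  define P' where "P' = {c \<in> P. pos_atoms (body c) \<inter> neg_atoms L = {}
     \<and> neg_atoms (body c) \<inter> pos_atoms L = {}
     \<and> set_option (head c) \<inter> (pos_atoms L \<union> neg_atoms L) = {}}"
  have fin: "finite P" "finite P'" and sub: "P' \<subseteq> P"
    using assms by (auto simp: finite_program_def P'_def)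
  have "residual P L = ?r ` P'" by (auto simp: residual_def P'_def)
  \<comment> \<open>Only an inequality, since different clauses may become equal after deleting
    literals.\<close>
  then have "program_size (residual P L) \<le> (\<Sum>c\<in>P'. ?w (?r c))"
    unfolding program_size_def using sum_image_le[OF fin(2), of ?w ?r] by simp
  also have "\<dots> \<le> (\<Sum>c\<in>P'. ?w c)"
    using assms sub by (intro sum_mono) (auto simp: finite_program_def intro!: card_mono)
  also have "\<dots> \<le> program_size P"
    unfolding program_size_def using fin sub by (intro sum_mono2) auto
  finally show ?thesis .
qed

text \<open>Lets additive constants be absorbed into multiples of the program size.\<close>

lemma program_size_pos:
  assumes "finite_program P" "definite P" "P \<noteq> {}"
  shows "program_size P \<ge> 1"
proof -
  obtain c where c: "c \<in> P" using assms by auto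
  with assms obtain p where "head c = Some p" by (auto simp: definite_def)
  then have "1 \<le> card (set_option (head c)) + card (body c)" by simp
  also have "\<dots> \<le> program_size P"
    unfolding program_size_def using assms c by (intro member_le_sum) (auto simp: finite_program_def)
  finally show ?thesis .
qed


section \<open>The recursion\<close>

lemma loop_Cons_steps: "steps (loop (\<lambda>l ls'. ret (l # ls')) A ls) = 1 + 2 * length A"
  by (simp add: loop_steps_const)

lemma val_loop_Cons: "val (loop (\<lambda>l ls'. ret (l # ls')) A ls) = rev A @ ls"
  by (rule loop_invariant[where I = "\<lambda>A ls'. ls' = rev A @ ls"]) auto

text \<open>The listed sets are pairwise different, so the recursive calls correspond one to one to
  the summands in the recurrence of \<open>branches\<close>.\<close>

lemma sum_list_lists_collection:
  assumes "lists_collection xss \<X>"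
  shows "(\<Sum>xs\<leftarrow>xss. F (set xs)) = sum F \<X>" and "length xss = card \<X>"
    and "set ` set xss = \<X>"
proof -
  have d: "distinct (map set xss)" "set (map set xss) = \<X>"
    using assms by (auto simp: lists_collection_def lists_set_def)
  show "(\<Sum>xs\<leftarrow>xss. F (set xs)) = sum F \<X>"
    using sum_list_distinct_conv_sum_set[OF d(1), of F] d(2) by (simp add: comp_def)
  show "length xss = card \<X>" using distinct_card[OF d(1)] d(2) by simp
  show "set ` set xss = \<X>" using d(2) by simp
qed

text \<open>The slack \<open>3 * D\<close> makes the induction work: of the \<open>3 * D\<close> saved in each of \<open>k \<ge> 2\<close> children,
  \<open>k * D\<close> pays for the edges, and the rest suffices for the node itself and its own slack.\<close>

lemma stable_proc_steps:
  fixes complete :: "'a program \<Rightarrow> 'a literal set set"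
    and c :: "'a program \<Rightarrow> 'a literal list list timed"
  assumes complete:
      "\<And>Q. finite_program Q \<Longrightarrow> definite Q \<Longrightarrow> Q \<noteq> {} \<Longrightarrow> complete_for Q (complete Q)"
    and procedure:
      "\<And>Q. finite_program Q \<Longrightarrow> definite Q \<Longrightarrow> Q \<noteq> {} \<Longrightarrow> lists_collection (val (c Q)) (complete Q)"
    and branching:
      "\<And>Q. finite_program Q \<Longrightarrow> definite Q \<Longrightarrow> Q \<noteq> {} \<Longrightarrow> card (complete Q) \<ge> 2"
    and P: "finite_program P" "definite P" "P \<noteq> {}" "lists_program cs P"
    and T: "\<And>L. residual P L \<noteq> {} \<Longrightarrow> steps (c (residual P L)) \<le> T"
    and D: "D = T + 60 * program_size P"
    and ls: "distinct ls" "set ls \<subseteq> Lit P"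
  shows "steps (stable_proc c cs ls out) + 3 * D \<le> 4 * D * branches complete P (set ls)"
  using ls
proof (induction "card (Lit P - set ls)" arbitrary: ls out rule: less_induct)
  case less
  let ?m = "program_size P" and ?L = "set ls"
  have cs: "program_of cs = P" using P(4) by (simp add: lists_program_def)
  have m: "?m \<ge> 1" by (rule program_size_pos[OF P(1-3)])
  have ls: "length ls \<le> 2 * ?m"
    using length_subset_Lit_le[OF P(1) less.prems] .
  have size: "list_size cs = ?m" by (rule list_size_eq_program_size[OF P(4,2)])
  note br = branches_eq[of complete P ?L, OF complete P(1,2)]
  have "complete_for Q (set ` set (val (c Q)))"
    if "finite_program Q" "definite Q" "Q \<noteq> {}" for Q
    using complete[OF that] sum_list_lists_collection(3)[OF procedure[OF that]] by simp
  then have eq: "stable_proc c cs ls out =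
     consistent_proc ls \<bind> (\<lambda>ok.
     if \<not> ok then ret out
     else residual_proc cs ls \<bind> (\<lambda>qs.
       if qs = [] then
         positive_proc ls \<bind> (\<lambda>M.
         stable_check_proc cs M \<bind> (\<lambda>b.
         ret (if b then M # out else out)))
       else
         c (program_of qs) \<bind> (\<lambda>As.
         loop (\<lambda>A out.
           loop (\<lambda>l ls'. ret (l # ls')) A ls \<bind> (\<lambda>ls'.
           stable_proc c cs ls' out)) As out)))"
    using P(2) by (intro stable_proc_eq) (simp_all add: cs)
  note res = residual_proc_steps[of cs ls]
  consider "\<not> consistent ?L" | "consistent ?L" "residual P ?L = {}"
    | "consistent ?L" "residual P ?L \<noteq> {}" by blast
  then show ?case
  proof cases
    case 1
    \<comment> \<open>At a leaf \<open>branches\<close> is 1, so a cost of at most \<open>D\<close>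
      leaves exactly the slack \<open>3 * D\<close>.\<close>
    then have "steps (stable_proc c cs ls out) \<le> D"
      using ls m by (simp add: eq consistent_proc consistent_proc_steps D)
    with 1 show ?thesis by (simp add: br)
  next
    case 2
    \<comment> \<open>With at most \<open>2 * ?m\<close> literals the subroutines take at most
      \<open>14 + 43 * ?m\<close> steps, which is below \<open>60 * ?m\<close> because
      \<open>?m\<close> is at least 1.\<close>
    have "steps (stable_proc c cs ls out) \<le> D"
      using 2 ls m size res stable_check_proc_steps[of cs "val (positive_proc ls)"]
        length_positive_proc[of ls]
      by (simp add: eq consistent_proc consistent_proc_steps residual_proc_Nil cs
          positive_proc_steps D)
    with 2 show ?thesis by (simp add: br)
  next
    case 3
    define Q where "Q = residual P ?L"
    define As where "As = val (c Q)"
    define b where "b A = branches complete P (?L \<union> A)" for A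
    note Q = residual_program[OF P(1,2), of ?L, folded Q_def] 3(2)[folded Q_def]
    note As = sum_list_lists_collection[OF procedure[OF Q], folded As_def]
    \<comment> \<open>The edge costs \<open>2 + 2 * length A\<close>, at most \<open>D\<close>, with
      \<open>Suc\<close> for the loop's own step; \<open>2 * D\<close> of the child's slack remains.
      The output \<open>out'\<close> is arbitrary because it depends on the earlier
      siblings.\<close>
    have child: "Suc (1 + 2 * length A + steps (stable_proc c cs (rev A @ ls) out')) + 2 * D
        \<le> 4 * D * b (set A)" if A: "A \<in> set As" for A out'
    proof -
      have "set A \<in> complete Q" "distinct A"
        using A As(3) procedure[OF Q] by (auto simp: lists_collection_def As_def)
      moreover from this have "set A \<subseteq> Lit Q" using complete[OF Q] by (auto simp: complete_for_def)
      \<comment> \<open>The literals of \<open>Q\<close> avoid \<open>?L\<close>, so the extended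
        list has no repetitions.\<close>
      ultimately have A': "distinct (rev A @ ls)" "set (rev A @ ls) \<subseteq> Lit P"
        using Lit_residual[of P ?L] less.prems by (auto simp: Q_def)
      have "card (Lit P - set (rev A @ ls)) < card (Lit P - ?L)"
        using complete_decreases[OF P(1), of ?L "complete Q" "set A"] complete[OF Q]
          \<open>set A \<in> complete Q\<close> by (simp add: Q_def Un_commute)
      from less.hyps[OF this A', of out']
      have "steps (stable_proc c cs (rev A @ ls) out') + 3 * D \<le> 4 * D * b (set A)"
        by (simp add: b_def Un_commute)
      moreover have "length A \<le> 2 * ?m"
        using length_subset_Lit_le[OF P(1) A'] by simp
      ultimately show ?thesis using m D by linarith
    qed
    define f where "f = (\<lambda>A out. loop (\<lambda>l ls'. ret (l # ls')) A ls \<bind> (\<lambda>ls'. stable_proc c cs ls' out))"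
    \<comment> \<open>By \<open>child\<close> the subtraction does not truncate; the final 1 offsets
      the \<open>Suc\<close> in \<open>loop_steps_le\<close>.\<close>
    define g where "g A = 4 * D * b (set A) - 2 * D - 1" for A
    have "steps (f A out') \<le> g A" if "A \<in> set As" for A out'
      using child[OF that, of out'] by (simp add: f_def g_def loop_Cons_steps val_loop_Cons)
    then have loop: "steps (loop f As out) \<le> 1 + (\<Sum>A\<leftarrow>As. Suc (g A))"
      by (rule loop_steps_le)
    have sum: "(\<Sum>A\<leftarrow>As'. Suc (g A)) + 2 * D * length As' \<le> 4 * D * (\<Sum>A\<leftarrow>As'. b (set A))"
      if "set As' \<subseteq> set As" for As'
      using that
    proof (induction As')
      case (Cons A As')
      have "Suc (g A) + 2 * D \<le> 4 * D * b (set A)"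
        using child[of A] Cons.prems by (fastforce simp: g_def)
      with Cons show ?case by (simp add: algebra_simps)
    qed simp
    \<comment> \<open>Two children already leave \<open>4 * D\<close>: \<open>D\<close> for this
      node and \<open>3 * D\<close> for its own slack.\<close>
    have "4 * D \<le> 2 * D * length As"
      using mult_le_mono2[OF branching[OF Q], of "2 * D"] by (simp add: As(2))
    have "(\<Sum>A\<leftarrow>As. b (set A)) = branches complete P ?L"
      unfolding As(1) using 3 by (simp add: br b_def Q_def)
    note sum[of As, OF subset_refl, unfolded this]
    with loop \<open>4 * D \<le> 2 * D * length As\<close>
    have "steps (loop f As out) + 4 * D \<le> 1 + 4 * D * branches complete P ?L"
      by linarith
    moreover have "steps (stable_proc c cs ls out) =
        steps (consistent_proc ls) + steps (residual_proc cs ls) + steps (c Q) + steps (loop f As out)"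
      using 3 unfolding eq f_def[symmetric]
      by (simp add: consistent_proc residual_proc residual_proc_Nil cs Q_def As_def)
    \<comment> \<open>The \<open>+ 1\<close> is the last step of the loop over
      \<open>As\<close>.\<close>
    moreover have "steps (consistent_proc ls) + steps (residual_proc cs ls) + steps (c Q) + 1 \<le> D"
      using ls m size res T[OF 3(2)] by (simp add: consistent_proc_steps D Q_def)
    ultimately show ?thesis by linarith
  qed
qed

text \<open>\<open>branching\<close> excludes chains of nodes with one child, which add work without
  raising \<open>branches\<close>. Monotonicity of \<open>t\<close> carries the time bound from
  residual programs to \<open>P\<close>. For empty \<open>P\<close> the right-hand side could be
  0.\<close>

theorem theorem1:
  fixes complete :: "'a program \<Rightarrow> 'a literal set set"
    and complete_proc :: "'a program \<Rightarrow> 'a literal list list timed"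
    and t :: "nat \<Rightarrow> real"
  assumes complete:
      "\<And>Q. finite_program Q \<Longrightarrow> definite Q \<Longrightarrow> Q \<noteq> {} \<Longrightarrow> complete_for Q (complete Q)"
    and procedure:
      "\<And>Q. finite_program Q \<Longrightarrow> definite Q \<Longrightarrow> Q \<noteq> {} \<Longrightarrow>
         lists_collection (val (complete_proc Q)) (complete Q)"
    and branching:
      "\<And>Q. finite_program Q \<Longrightarrow> definite Q \<Longrightarrow> Q \<noteq> {} \<Longrightarrow> card (complete Q) \<ge> 2"
    and t_nonneg: "\<And>m. t m \<ge> 0"
    and t_mono: "mono t"
    and time:
      "\<exists>C. \<forall>Q. finite_program Q \<and> definite Q \<and> Q \<noteq> {} \<longrightarrow>
         real (steps (complete_proc Q)) \<le> C * t (program_size Q)"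
  shows "\<exists>C. \<forall>P L cs ls. finite_program P \<and> definite P \<and> P \<noteq> {} \<and> L \<subseteq> Lit P \<and>
           lists_program cs P \<and> lists_set ls L \<longrightarrow>
           real (steps (stable_proc complete_proc cs ls [])) \<le>
             C * (real (branches complete P L) * (t (program_size P) + real (program_size P)))"
proof -
  obtain C where C: "\<And>Q. finite_program Q \<Longrightarrow> definite Q \<Longrightarrow> Q \<noteq> {} \<Longrightarrow>
      real (steps (complete_proc Q)) \<le> C * t (program_size Q)"
    using time by blast
  \<comment> \<open>\<open>C\<close> might be negative, and multiplying by \<open>max C 0\<close>
    preserves inequalities. \<open>K\<close> dominates both this factor and the 60 in
    \<open>D\<close>.\<close>
  define K where "K = max C 0 + 61"
  have "real (steps (stable_proc complete_proc cs ls [])) \<le>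
      4 * K * (real (branches complete P L) * (t (program_size P) + real (program_size P)))"
    if P: "finite_program P" "definite P" "P \<noteq> {}" "lists_program cs P"
      and L: "L \<subseteq> Lit P" "lists_set ls L" for P L cs ls
  proof -
    let ?m = "program_size P"
    \<comment> \<open>Rounding down still bounds step counts, which are natural numbers, and keeps
      \<open>T\<close> below the real bound.\<close>
    define T where "T = nat \<lfloor>max C 0 * t ?m\<rfloor>"
    have T: "steps (complete_proc (residual P L')) \<le> T" if "residual P L' \<noteq> {}" for L'
    proof -
      note Q = residual_program[OF P(1,2), of L'] that
      have "real (steps (complete_proc (residual P L'))) \<le> C * t (program_size (residual P L'))"
        by (rule C[OF Q])
      also have "\<dots> \<le> max C 0 * t ?m"
        using program_size_residual_le[OF P(1)] t_mono t_nonneg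
        by (intro mult_mono) (auto simp: mono_def)
      finally show ?thesis by (simp add: T_def le_nat_floor)
    qed
    define D where "D = T + 60 * ?m"
    have "real D \<le> max C 0 * t ?m + 60 * ?m"
      using t_nonneg[of ?m] by (simp add: D_def T_def)
    also have "\<dots> \<le> K * (t ?m + ?m)"
      using t_nonneg[of ?m] by (simp add: K_def algebra_simps)
    finally have D: "real D \<le> K * (t ?m + ?m)" .
    have "steps (stable_proc complete_proc cs ls []) + 3 * D \<le> 4 * D * branches complete P (set ls)"
      by (rule stable_proc_steps[OF complete procedure branching P T D_def])
        (use L in \<open>auto simp: lists_set_def\<close>)
    then have "steps (stable_proc complete_proc cs ls []) \<le> 4 * D * branches complete P L"
      using L(2) by (simp add: lists_set_def)
    then have "real (steps (stable_proc complete_proc cs ls [])) \<le>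
        real (4 * D * branches complete P L)"
      by (rule of_nat_mono)
    also have "\<dots> = 4 * real D * real (branches complete P L)" by simp
    also have "\<dots> \<le> 4 * (K * (t ?m + ?m)) * real (branches complete P L)"
      using D by (intro mult_right_mono) auto
    finally show ?thesis by (simp add: mult_ac)
  qed
  then show ?thesis by blast
qed

end
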